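(* Define, for $n\ge 0$, $$\alpha_n^{(1)}(a,k)=\frac{(qa^2/k^2;q)_n}{(q;q)_n}\left(\frac{k}{a}\right)^n,\qquad \beta_n^{(1)}(a,k)=\frac{(qa/k,k;q)_n}{(k^2/a,q;q)_n}\,\frac{(k^2/a;q)_{2n}}{(aq;q)_{2n}}.$$ Then $(\alpha_n^{(1)}(a,k),\beta_n^{(1)}(a,k))$ is a WP-Bailey pair, i.e. for every integer $n\ge 0$, $$\beta_n^{(1)}(a,k)=\sum_{j=0}^{n}\frac{(k/a;q)_{n-j}(k;q)_{n+j}}{(q;q)_{n-j}(aq;q)_{n+j}}\,\alpha_j^{(1)}(a,k).$$
   Context: For an integer $n\ge 0$, $(x;q)_n=\prod_{i=0}^{n-1}(1-xq^i)$ and $(x_1,\dots,x_m;q)_n=\prod_{j=1}^m(x_j;q)_n$. Here $q,a,k$ are nonzero complex numbers such that none of the denominators vanish. A pair of sequences $(\alpha_n(a,k),\beta_n(a,k))_{n\ge0}$ is a WP-Bailey pair if $\beta_{n}(a,k) = \sum_{j=0}^{n}\frac{(k/a;q)_{n-j}(k;q)_{n+j}}{(q;q)_{n-j}(aq;q)_{n+j}}\alpha_{j}(a,k)$ for all $n\ge 0$. *)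

theory Defs
  imports Complex_Main
begin

definition qpoch :: "complex \<Rightarrow> complex \<Rightarrow> nat \<Rightarrow> complex"
  where "qpoch x q n = (\<Prod>i<n. 1 - x * q ^ i)"

definition WP_Bailey_pair ::
  "complex \<Rightarrow> complex \<Rightarrow> complex \<Rightarrow> (nat \<Rightarrow> complex) \<Rightarrow> (nat \<Rightarrow> complex) \<Rightarrow> bool"
  where "WP_Bailey_pair q a k \<alpha> \<beta> \<longleftrightarrow>
    (\<forall>n. \<beta> n = (\<Sum>j\<le>n.
       (qpoch (k / a) q (n - j) * qpoch k q (n + j)) /
       (qpoch q q (n - j) * qpoch (a * q) q (n + j)) * \<alpha> j))"

definition alpha1 :: "complex \<Rightarrow> complex \<Rightarrow> complex \<Rightarrow> nat \<Rightarrow> complex"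
  where "alpha1 q a k n = qpoch (q * a\<^sup>2 / k\<^sup>2) q n / qpoch q q n * (k / a) ^ n"

definition beta1 :: "complex \<Rightarrow> complex \<Rightarrow> complex \<Rightarrow> nat \<Rightarrow> complex"
  where "beta1 q a k n =
    (qpoch (q * a / k) q n * qpoch k q n) / (qpoch (k\<^sup>2 / a) q n * qpoch q q n) *
    (qpoch (k\<^sup>2 / a) q (2 * n) / qpoch (a * q) q (2 * n))"

end

theory Submission
  imports Defs
begin

text \<open>
  The sum is a terminating balanced \<open>\<^sub>3\<phi>\<^sub>2\<close>. Writing \<open>(x)\<^sub>n\<close> for \<open>(x;q)\<^sub>n\<close>, the q-Pfaff--Saalschuetz
  formula, multiplied through by \<open>(ABD)\<^sub>n\<close> so that the lower parameter leaves the denominator,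
  \<open>\<Sum>\<^sub>j (A)\<^sub>j (B)\<^sub>j (D)\<^sub>n\<^sub>-\<^sub>j (ABDq\<^sup>j)\<^sub>n\<^sub>-\<^sub>j D\<^sup>j / ((q)\<^sub>j (q)\<^sub>n\<^sub>-\<^sub>j) = (AD)\<^sub>n (BD)\<^sub>n / (q)\<^sub>n\<close>
  is applied with \<open>A = kq\<^sup>n\<close>, \<open>B = qa\<^sup>2/k\<^sup>2\<close>, \<open>D = k/a\<close>. The formula follows by induction
  on \<open>n\<close>, because \<open>(1 - q\<^sup>n\<^sup>+\<^sup>1)\<close> times the summand for \<open>n + 1\<close> differs from
  \<open>(1 - ADq\<^sup>n)(1 - BDq\<^sup>n)\<close> times the summand for \<open>n\<close> by a telescoping term (a WZ certificate).
\<close>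

lemma qpoch_0 [simp]: "qpoch x q 0 = 1"
  by (simp add: qpoch_def)

lemma qpoch_Suc: "qpoch x q (Suc n) = qpoch x q n * (1 - x * q ^ n)"
  by (simp add: qpoch_def)

lemma qpoch_add: "qpoch x q (m + n) = qpoch x q m * qpoch (x * q ^ m) q n"
  by (induction n) (simp_all add: qpoch_Suc power_add mult.assoc)

lemma qpoch_Suc_left: "qpoch x q (Suc n) = (1 - x) * qpoch (x * q) q n"
  using qpoch_add[of x q 1 n] by (simp add: qpoch_Suc)

text \<open>The second index \<open>m\<close> stands for \<open>n - i\<close>; this avoids truncated subtraction.\<close>

definition saal :: "complex \<Rightarrow> complex \<Rightarrow> complex \<Rightarrow> complex \<Rightarrow> nat \<Rightarrow> nat \<Rightarrow> complex"
  where "saal q A B D i m =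
    qpoch A q i * qpoch B q i * qpoch D q m * D ^ i * qpoch (A * B * D * q ^ i) q m /
    (qpoch q q i * qpoch q q m)"

text \<open>The WZ certificate: \<open>saal q A B D i m\<close> times the factor
  \<open>q ^ m * D * (1 - A * q ^ i) * (1 - B * q ^ i)\<close>.\<close>

definition saal_cert :: "complex \<Rightarrow> complex \<Rightarrow> complex \<Rightarrow> complex \<Rightarrow> nat \<Rightarrow> nat \<Rightarrow> complex"
  where "saal_cert q A B D i m =
    q ^ m * qpoch A q (Suc i) * qpoch B q (Suc i) * qpoch D q m * D ^ Suc i *
    qpoch (A * B * D * q ^ i) q m / (qpoch q q i * qpoch q q m)"

text \<open>At index 0 there is no preceding certificate. With \<open>y = q ^ m\<close> this is
  \<open>(1 - D*y)*(1 - A*B*D*y) = (1 - A*D*y)*(1 - B*D*y) - y*D*(1 - A)*(1 - B)\<close>.\<close>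

lemma saal_step_first:
  assumes "\<And>n. qpoch q q n \<noteq> 0"
  shows "(1 - q ^ Suc m) * saal q A B D 0 (Suc m) =
    (1 - A * D * q ^ m) * (1 - B * D * q ^ m) * saal q A B D 0 m - saal_cert q A B D 0 m"
proof -
  have q: "qpoch q q (Suc m) = qpoch q q m * (1 - q ^ Suc m)" "1 - q ^ Suc m \<noteq> 0"
    using assms[of "Suc m"] by (auto simp: qpoch_Suc)
  define K where "K = qpoch D q m * qpoch (A * B * D) q m / qpoch q q m"
  have "(1 - q ^ Suc m) * saal q A B D 0 (Suc m) = K * ((1 - D * q ^ m) * (1 - A * B * D * q ^ m))"
    using q(2) unfolding saal_def q(1) K_def by (simp add: qpoch_Suc)
  moreover have "saal q A B D 0 m = K"
    by (simp add: saal_def K_def)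
  moreover have "saal_cert q A B D 0 m = K * (q ^ m * D * (1 - A) * (1 - B))"
    by (simp add: saal_cert_def K_def qpoch_Suc)
  ultimately show ?thesis
    by (simp add: algebra_simps)
qed

lemma saal_step:
  assumes "\<And>n. qpoch q q n \<noteq> 0"
  shows "(1 - q ^ (i + m + 2)) * saal q A B D (Suc i) (Suc m) =
    (1 - A * D * q ^ (i + m + 1)) * (1 - B * D * q ^ (i + m + 1)) * saal q A B D (Suc i) m
    + saal_cert q A B D i (Suc m) - saal_cert q A B D (Suc i) m"
proof -
  have q: "qpoch q q (Suc n) = qpoch q q n * (1 - q ^ Suc n)" "1 - q ^ Suc n \<noteq> 0" for n
    using assms[of "Suc n"] by (auto simp: qpoch_Suc)
  define x y where "x = q ^ i" and "y = q ^ m"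
  define R where "R = qpoch (A * B * D * q ^ Suc i) q m"
  \<comment> \<open>A common factor of all four terms: each is \<open>K\<close> times a polynomial
    in \<open>x\<close>, \<open>y\<close> and the parameters, so a polynomial identity
    remains.\<close>
  define K where "K = qpoch A q (Suc i) * qpoch B q (Suc i) * D ^ Suc i * qpoch D q m * R /
    (qpoch q q (Suc i) * qpoch q q (Suc m))"
  have nz: "1 - q * x \<noteq> 0" "1 - q * y \<noteq> 0"
    using q(2)[of i] q(2)[of m] by (auto simp: x_def y_def)
  have qi: "qpoch q q (Suc i) = qpoch q q i * (1 - q * x)"
    and qm: "qpoch q q (Suc m) = qpoch q q m * (1 - q * y)"
    by (simp_all add: q x_def y_def)
  have R: "qpoch (A * B * D * q ^ Suc i) q (Suc m) = R * (1 - A * B * D * x * y * q)"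
    "qpoch (A * B * D * q ^ i) q (Suc m) = (1 - A * B * D * x) * R"
    by (simp add: R_def qpoch_Suc x_def y_def mult_ac)
       (simp add: R_def qpoch_Suc_left x_def mult_ac)
  have "saal q A B D (Suc i) (Suc m) = K * ((1 - D * y) * (1 - A * B * D * x * y * q))"
    unfolding saal_def K_def R by (simp add: qpoch_Suc[of D] y_def mult_ac)
  moreover have "saal q A B D (Suc i) m = K * (1 - q * y)"
    using nz unfolding saal_def K_def R_def[symmetric] qm by simp
  moreover have "saal_cert q A B D i (Suc m) =
      K * (q * y * (1 - q * x) * (1 - D * y) * (1 - A * B * D * x))"
    using nz unfolding saal_cert_def K_def R qi
    by (simp add: qpoch_Suc[of D] y_def mult_ac)
  moreover have "saal_cert q A B D (Suc i) m =
      K * (y * D * (1 - A * x * q) * (1 - B * x * q) * (1 - q * y))"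
    using nz unfolding saal_cert_def K_def R_def[symmetric] qm qpoch_Suc[of A q "Suc i"]
      qpoch_Suc[of B q "Suc i"]
    by (simp add: x_def y_def mult_ac)
  moreover have "q ^ (i + m + 2) = x * y * q * q" "q ^ (i + m + 1) = x * y * q"
    by (simp_all add: x_def y_def power_add power2_eq_square)
  ultimately show ?thesis
    by (simp only:) (simp add: algebra_simps)
qed

text \<open>The top summand of the longer sum has no partner in the shorter one; it cancels the
  certificate that telescoping leaves over.\<close>

lemma saal_step_last:
  assumes "\<And>n. qpoch q q n \<noteq> 0"
  shows "(1 - q ^ Suc i) * saal q A B D (Suc i) 0 = saal_cert q A B D i 0"
  using assms[of "Suc i"] by (simp add: saal_def saal_cert_def qpoch_Suc[of q])

text \<open>Stopping at \<open>p\<close> with \<open>n\<close> fixed lets the certificates telescope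
  by induction on \<open>p\<close>.\<close>

lemma saal_partial_sum:
  assumes "\<And>n. qpoch q q n \<noteq> 0" and "p \<le> n"
  shows "(1 - q ^ Suc n) * (\<Sum>j\<le>p. saal q A B D j (Suc n - j)) =
    (1 - A * D * q ^ n) * (1 - B * D * q ^ n) * (\<Sum>j\<le>p. saal q A B D j (n - j))
    - saal_cert q A B D p (n - p)"
  using \<open>p \<le> n\<close>
proof (induction p)
  case 0
  then show ?case
    using saal_step_first[OF assms(1)] by simp
next
  case (Suc p)
  then obtain m where m: "n = Suc (p + m)"
    using less_iff_Suc_add[of p n] by auto
  have "(1 - q ^ Suc n) * (\<Sum>j\<le>p. saal q A B D j (Suc n - j)) =
      (1 - A * D * q ^ n) * (1 - B * D * q ^ n) * (\<Sum>j\<le>p. saal q A B D j (n - j))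
      - saal_cert q A B D p (Suc m)"
    using Suc by (simp add: m)
  moreover have "(1 - q ^ Suc n) * saal q A B D (Suc p) (Suc n - Suc p) =
      (1 - A * D * q ^ n) * (1 - B * D * q ^ n) * saal q A B D (Suc p) (n - Suc p)
      + saal_cert q A B D p (Suc m) - saal_cert q A B D (Suc p) (n - Suc p)"
    using saal_step[OF assms(1), of p m A B D] by (simp add: m)
  ultimately show ?case
    unfolding sum.atMost_Suc distrib_left by simp
qed

lemma q_Saalschuetz:
  assumes "\<And>n. qpoch q q n \<noteq> 0"
  shows "(\<Sum>j\<le>n. saal q A B D j (n - j)) = qpoch (A * D) q n * qpoch (B * D) q n / qpoch q q n"
proof (induction n)
  case 0
  then show ?case
    by (simp add: saal_def)
next
  case (Suc n)
  have q: "qpoch q q (Suc n) = qpoch q q n * (1 - q ^ Suc n)" "1 - q ^ Suc n \<noteq> 0"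
    using assms[of "Suc n"] by (auto simp: qpoch_Suc)
  have "(1 - q ^ Suc n) * (\<Sum>j\<le>Suc n. saal q A B D j (Suc n - j)) =
      (1 - A * D * q ^ n) * (1 - B * D * q ^ n) * (\<Sum>j\<le>n. saal q A B D j (n - j))"
    using saal_partial_sum[OF assms, of n n A B D] saal_step_last[OF assms, of n A B D]
    unfolding sum.atMost_Suc distrib_left by simp
  also have "\<dots> = (1 - q ^ Suc n) *
      (qpoch (A * D) q (Suc n) * qpoch (B * D) q (Suc n) / qpoch q q (Suc n))"
    using q(2) unfolding Suc.IH q(1) by (simp add: qpoch_Suc)
  finally show ?case
    by (rule mult_left_cancel[OF q(2), THEN iffD1])
qed

theorem lemma1:
  fixes q a k :: complex
  assumes "q \<noteq> 0" "a \<noteq> 0" "k \<noteq> 0"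
    and "\<And>n. qpoch q q n \<noteq> 0"
    and "\<And>n. qpoch (a * q) q n \<noteq> 0"
    and "\<And>n. qpoch (k\<^sup>2 / a) q n \<noteq> 0"
  shows "WP_Bailey_pair q a k (alpha1 q a k) (beta1 q a k)"
  unfolding WP_Bailey_pair_def
proof
  fix n
  let ?A = "k * q ^ n" and ?B = "q * a\<^sup>2 / k\<^sup>2" and ?D = "k / a"
  have ABD: "?A * ?B * ?D = a * q * q ^ n" and AD: "?A * ?D = k\<^sup>2 / a * q ^ n"
    and BD: "?B * ?D = q * a / k"
    using assms(2,3) by (simp_all add: field_simps power2_eq_square)
  \<comment> \<open>Splitting \<open>(k)_(n+j)\<close> at \<open>n\<close> produces
    \<open>(A)_j\<close>. Splitting \<open>(aq)_(2n)\<close> at \<open>n+j\<close> turns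
    \<open>1/(aq)_(n+j)\<close> into \<open>(ABDq^j)_(n-j) / (aq)_(2n)\<close>.\<close>
  have term_eq: "(qpoch (k / a) q (n - j) * qpoch k q (n + j)) /
      (qpoch q q (n - j) * qpoch (a * q) q (n + j)) * alpha1 q a k j =
      qpoch k q n / qpoch (a * q) q (2 * n) * saal q ?A ?B ?D j (n - j)" if "j \<le> n" for j
  proof -
    have "(n + j) + (n - j) = 2 * n"
      using that by simp
    then have *: "qpoch (a * q) q (2 * n) =
        qpoch (a * q) q (n + j) * qpoch (a * q * q ^ n * q ^ j) q (n - j)"
      using qpoch_add[of "a * q" q "n + j" "n - j"] by (simp only: power_add mult_ac)
    then have "qpoch (a * q * q ^ n * q ^ j) q (n - j) \<noteq> 0"
      using assms(5)[of "2 * n"] by auto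
    then show ?thesis
      unfolding saal_def alpha1_def ABD * qpoch_add[of k q n j] by (simp add: mult_ac)
  qed
  have "(\<Sum>j\<le>n. (qpoch (k / a) q (n - j) * qpoch k q (n + j)) /
      (qpoch q q (n - j) * qpoch (a * q) q (n + j)) * alpha1 q a k j) =
      qpoch k q n / qpoch (a * q) q (2 * n) * (\<Sum>j\<le>n. saal q ?A ?B ?D j (n - j))"
    unfolding sum_distrib_left by (intro sum.cong refl term_eq) simp
  also have "\<dots> = qpoch k q n / qpoch (a * q) q (2 * n) *
      (qpoch (k\<^sup>2 / a * q ^ n) q n * qpoch (q * a / k) q n / qpoch q q n)"
    unfolding q_Saalschuetz[OF assms(4)] AD BD ..
  \<comment> \<open>Splitting \<open>(k^2/a)_(2n)\<close> at \<open>n\<close> cancels the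
    denominator \<open>(k^2/a)_n\<close> of \<open>beta1\<close>.\<close>
  also have "\<dots> = beta1 q a k n"
    using assms(6)[of n] unfolding beta1_def mult_2 qpoch_add[of "k\<^sup>2 / a" q n n]
    by (simp add: mult_ac)
  finally show "beta1 q a k n = (\<Sum>j\<le>n. (qpoch (k / a) q (n - j) * qpoch k q (n + j)) /
      (qpoch q q (n - j) * qpoch (a * q) q (n + j)) * alpha1 q a k j)" ..
qed

end
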